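(* Let $\varphi$ be a track function and let $\delta:[0,1]\to[0,1]$ be increasing with $\delta(1)=1$ and $\delta(t)\le\min\{t,\varphi(t)\}$ for all $t\in[0,1]$. Let $\psi:[0,1]\to[0,1]$ be increasing with $\psi(0)=0$, and assume that the functions $$\eta(y)=\delta(\varphi^{-1}(y))-\psi(\varphi^{-1}(y)),\quad \chi(y)=y-\eta(y),\quad \xi(x)=x-\psi(x)$$ are non-negative and increasing on $[0,1]$. Define $S_\psi(x,y)=\psi(x)\wedge\chi(y)$, $T_\psi(x,y)=\xi(x)\wedge\eta(y)$ and $C_\psi(x,y)=S_\psi(x,y)+T_\psi(x,y)$ for $(x,y)\in[0,1]^2$. Then $C_\psi$ is a copula, and $C_\psi(x,\varphi(x))=\delta(x)$ for all $x\in[0,1]$.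
   Context: "Increasing" means non-decreasing; $a\wedge b=\min\{a,b\}$. A track function is a strictly increasing continuous $\varphi:[0,1]\to[0,1]$ with $\varphi(0)=0$, $\varphi(1)=1$. A bivariate copula is a function $C:[0,1]^2\to[0,1]$ with $C(x,0)=C(0,x)=0$, $C(x,1)=C(1,x)=x$ and $C(x_2,y_2)-C(x_1,y_2)-C(x_2,y_1)+C(x_1,y_1)\ge0$ whenever $x_1\le x_2$, $y_1\le y_2$. *)

theory Defs
  imports Complex_Main "HOL-Library.FuncSet"
begin

text \<open>
  Functions on the unit interval are total functions on the reals; only their values
  on \<^term>\<open>{0..1::real}\<close> are constrained.
\<close>

definition track_function :: "(real \<Rightarrow> real) \<Rightarrow> bool" where
  "track_function \<phi> \<longleftrightarrow>
     \<phi> \<in> {0..1} \<rightarrow> {0..1} \<and> strict_mono_on {0..1} \<phi> \<and> continuous_on {0..1} \<phi> \<and>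
     \<phi> 0 = 0 \<and> \<phi> 1 = 1"

definition copula :: "(real \<Rightarrow> real \<Rightarrow> real) \<Rightarrow> bool" where
  "copula C \<longleftrightarrow>
     (\<forall>x\<in>{0..1}. \<forall>y\<in>{0..1}. C x y \<in> {0..1}) \<and>
     (\<forall>x\<in>{0..1}. C x 0 = 0 \<and> C 0 x = 0 \<and> C x 1 = x \<and> C 1 x = x) \<and>
     (\<forall>x1\<in>{0..1}. \<forall>x2\<in>{0..1}. \<forall>y1\<in>{0..1}. \<forall>y2\<in>{0..1}.
        x1 \<le> x2 \<longrightarrow> y1 \<le> y2 \<longrightarrow> C x2 y2 - C x1 y2 - C x2 y1 + C x1 y1 \<ge> 0)"

text \<open>
  The inverse of a track function is taken relative to the unit interval, on which it is a
  bijection; its values outside are irrelevant.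
\<close>

definition eta_fun :: "(real \<Rightarrow> real) \<Rightarrow> (real \<Rightarrow> real) \<Rightarrow> (real \<Rightarrow> real) \<Rightarrow> real \<Rightarrow> real" where
  "eta_fun \<phi> \<delta> \<psi> y = \<delta> (inv_into {0..1} \<phi> y) - \<psi> (inv_into {0..1} \<phi> y)"

definition chi_fun :: "(real \<Rightarrow> real) \<Rightarrow> (real \<Rightarrow> real) \<Rightarrow> (real \<Rightarrow> real) \<Rightarrow> real \<Rightarrow> real" where
  "chi_fun \<phi> \<delta> \<psi> y = y - eta_fun \<phi> \<delta> \<psi> y"

definition xi_fun :: "(real \<Rightarrow> real) \<Rightarrow> real \<Rightarrow> real" where
  "xi_fun \<psi> x = x - \<psi> x"

definition S_fun :: "(real \<Rightarrow> real) \<Rightarrow> (real \<Rightarrow> real) \<Rightarrow> (real \<Rightarrow> real) \<Rightarrow> real \<Rightarrow> real \<Rightarrow> real" where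
  "S_fun \<phi> \<delta> \<psi> x y = min (\<psi> x) (chi_fun \<phi> \<delta> \<psi> y)"

definition T_fun :: "(real \<Rightarrow> real) \<Rightarrow> (real \<Rightarrow> real) \<Rightarrow> (real \<Rightarrow> real) \<Rightarrow> real \<Rightarrow> real \<Rightarrow> real" where
  "T_fun \<phi> \<delta> \<psi> x y = min (xi_fun \<psi> x) (eta_fun \<phi> \<delta> \<psi> y)"

definition C_fun :: "(real \<Rightarrow> real) \<Rightarrow> (real \<Rightarrow> real) \<Rightarrow> (real \<Rightarrow> real) \<Rightarrow> real \<Rightarrow> real \<Rightarrow> real" where
  "C_fun \<phi> \<delta> \<psi> x y = S_fun \<phi> \<delta> \<psi> x y + T_fun \<phi> \<delta> \<psi> x y"

end

theory Submission
  imports Defs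
begin

text \<open>Since \<open>\<psi> + \<xi>\<close> and \<open>\<chi> + \<eta>\<close> are both the
  identity on the unit interval, \<open>C_fun\<close> splits the mass of each margin into two parts
  and couples each pair of parts by a minimum, as comonotonically as possible. A minimum of
  increasing functions of separate variables is 2-increasing (\<open>min_two_increasing\<close>),
  hence so is the sum. The margins come out right because the total masses match:
  \<open>\<eta> 1 = \<xi> 1\<close> and \<open>\<chi> 1 = \<psi> 1\<close>. On the track,
  \<open>\<delta> t \<le> min t (\<phi> t)\<close> decides both minima, and the terms in
  \<open>\<psi>\<close> cancel (\<open>track_function_eta\<close>).\<close>

text \<open>As a function of \<open>t\<close>, \<open>min b t - min a t\<close> is 0 up to
  \<open>a\<close>, grows with slope 1 until \<open>b\<close> and is constant afterwards, so it is
  increasing.\<close>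

lemma min_two_increasing:
  fixes a b c d :: "'a::linordered_ab_group_add"
  assumes "a \<le> b" and "c \<le> d"
  shows "0 \<le> min b d - min a d - min b c + min a c"
  using assms by (auto simp: min_def algebra_simps intro: add_mono)

lemma track_function_inv_into:
  assumes "track_function \<phi>" and "x \<in> {0..1}"
  shows "inv_into {0..1} \<phi> (\<phi> x) = x"
  using assms strict_mono_on_imp_inj_on inv_into_f_f unfolding track_function_def by metis

text \<open>Removes the inverse: wherever a value of \<open>\<eta>\<close> is computed later, the
  point has the form \<open>\<phi> x\<close>, either an endpoint or a point of the track.\<close>

lemma track_function_eta:
  assumes "track_function \<phi>" and "x \<in> {0..1}"
  shows "eta_fun \<phi> \<delta> \<psi> (\<phi> x) = \<delta> x - \<psi> x"
  using track_function_inv_into[OF assms] by (simp add: eta_fun_def)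

theorem theorem3p4:
  fixes \<phi> \<delta> \<psi> :: "real \<Rightarrow> real"
  assumes "track_function \<phi>"
    and "\<delta> \<in> {0..1} \<rightarrow> {0..1}" and "mono_on {0..1} \<delta>" and "\<delta> 1 = 1"
    and "\<forall>t\<in>{0..1}. \<delta> t \<le> min t (\<phi> t)"
    and "\<psi> \<in> {0..1} \<rightarrow> {0..1}" and "mono_on {0..1} \<psi>" and "\<psi> 0 = 0"
    and "\<forall>y\<in>{0..1}. eta_fun \<phi> \<delta> \<psi> y \<ge> 0" and "mono_on {0..1} (eta_fun \<phi> \<delta> \<psi>)"
    and "\<forall>y\<in>{0..1}. chi_fun \<phi> \<delta> \<psi> y \<ge> 0" and "mono_on {0..1} (chi_fun \<phi> \<delta> \<psi>)"
    and "\<forall>x\<in>{0..1}. xi_fun \<psi> x \<ge> 0" and "mono_on {0..1} (xi_fun \<psi>)"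
  shows "copula (C_fun \<phi> \<delta> \<psi>) \<and> (\<forall>x\<in>{0..1}. C_fun \<phi> \<delta> \<psi> x (\<phi> x) = \<delta> x)"
proof -
  let ?\<eta> = "eta_fun \<phi> \<delta> \<psi>" and ?\<chi> = "chi_fun \<phi> \<delta> \<psi>" and ?\<xi> = "xi_fun \<psi>"
  have C: "C_fun \<phi> \<delta> \<psi> x y = min (\<psi> x) (?\<chi> y) + min (?\<xi> x) (?\<eta> y)" for x y
    by (simp add: C_fun_def S_fun_def T_fun_def)
  have \<chi>: "?\<chi> y = y - ?\<eta> y" and \<xi>: "?\<xi> x = x - \<psi> x" for x y
    by (simp_all add: chi_fun_def xi_fun_def)
  have \<phi>01: "\<phi> 0 = 0" "\<phi> 1 = 1"
    using assms(1) by (simp_all add: track_function_def)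
  have \<delta>_bound: "0 \<le> \<delta> t" "\<delta> t \<le> t" "\<delta> t \<le> \<phi> t" if "t \<in> {0..1}" for t
    using that assms(2,5) by auto
  have \<delta>0: "\<delta> 0 = 0"
    using \<delta>_bound(1,2)[of 0] by simp
  \<comment> \<open>Both endpoints are fixed by \<open>\<phi>\<close>. The second value is
    \<open>\<xi> 1\<close>, and it gives \<open>\<chi> 1 = \<psi> 1\<close>.\<close>
  have \<eta>01: "?\<eta> 0 = 0" "?\<eta> 1 = 1 - \<psi> 1"
    using track_function_eta[OF assms(1), of 0 \<delta> \<psi>] track_function_eta[OF assms(1), of 1 \<delta> \<psi>]
      \<phi>01 \<delta>0 assms(4,8) by simp_all
  have nonneg: "0 \<le> \<psi> t" "0 \<le> ?\<eta> t" "0 \<le> ?\<chi> t" "0 \<le> ?\<xi> t" if "t \<in> {0..1}" for t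
    using that assms(6,9,11,13) by auto
  have mono: "\<psi> s \<le> \<psi> t" "?\<eta> s \<le> ?\<eta> t" "?\<chi> s \<le> ?\<chi> t" "?\<xi> s \<le> ?\<xi> t"
    if "s \<in> {0..1}" "t \<in> {0..1}" "s \<le> t" for s t
    using that assms(7,10,12,14) unfolding mono_on_def by blast+
  \<comment> \<open>The upper bound is \<open>\<psi> x + \<xi> x = x\<close>.\<close>
  have range: "C_fun \<phi> \<delta> \<psi> x y \<in> {0..1}" if "x \<in> {0..1}" "y \<in> {0..1}" for x y
    using nonneg[OF that(1)] nonneg[OF that(2)] that(1) unfolding C by (auto simp: \<xi>)
  \<comment> \<open>All four functions vanish at 0. When one argument is 1, monotonicity and the
    matching values at 1 make each minimum the function of the other argument:
    \<open>\<psi> x + \<xi> x\<close> or \<open>\<chi> x + \<eta> x\<close>, both equal to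
    \<open>x\<close>.\<close>
  have margins: "C_fun \<phi> \<delta> \<psi> x 0 = 0 \<and> C_fun \<phi> \<delta> \<psi> 0 x = 0 \<and>
      C_fun \<phi> \<delta> \<psi> x 1 = x \<and> C_fun \<phi> \<delta> \<psi> 1 x = x" if "x \<in> {0..1}" for x
    using nonneg[OF that] mono[OF that, of 1] that \<eta>01 assms(8)
    unfolding C \<chi> \<xi> by (auto simp: min_def)
  have two_increasing:
    "0 \<le> C_fun \<phi> \<delta> \<psi> x2 y2 - C_fun \<phi> \<delta> \<psi> x1 y2 - C_fun \<phi> \<delta> \<psi> x2 y1 + C_fun \<phi> \<delta> \<psi> x1 y1"
    if "x1 \<in> {0..1}" "x2 \<in> {0..1}" "y1 \<in> {0..1}" "y2 \<in> {0..1}" "x1 \<le> x2" "y1 \<le> y2"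
    for x1 x2 y1 y2
    using min_two_increasing[OF mono(1)[OF that(1,2,5)] mono(3)[OF that(3,4,6)]]
      min_two_increasing[OF mono(4)[OF that(1,2,5)] mono(2)[OF that(3,4,6)]]
    unfolding C by linarith
  \<comment> \<open>From \<open>\<delta> x \<le> \<phi> x\<close> follows
    \<open>\<psi> x \<le> \<chi> (\<phi> x)\<close>, and from \<open>\<delta> x \<le> x\<close>
    follows \<open>\<eta> (\<phi> x) \<le> \<xi> x\<close>; what remains is
    \<open>\<psi> x + (\<delta> x - \<psi> x)\<close>.\<close>
  have "C_fun \<phi> \<delta> \<psi> x (\<phi> x) = \<delta> x" if "x \<in> {0..1}" for x
    using track_function_eta[OF assms(1) that] \<delta>_bound[OF that]
    unfolding C \<chi> \<xi> by simp
  with range margins two_increasing show ?thesis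
    unfolding copula_def by blast
qed

end
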